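(* Almost all trees have at least two cherries: if $C_n$ denotes the number of cherries in a tree drawn uniformly at random from the set of all labelled trees on $n$ vertices, then $$\lim_{n\to\infty} \mathbb{P}[C_n \ge 2] = 1.$$
   Context: All graphs are finite, undirected, without loops and without multiple edges; a tree is a connected graph without cycles. A labelled tree on $n$ vertices is a tree with vertices $v_1,\dots,v_n$ (two labelled trees are equal iff they have the same edge set); the set of labelled trees on $n$ vertices carries the uniform probability measure. A triple $(u_1,u_2,v)$ of vertices of a graph is a cherry if $u_1,u_2,v$ are pairwise distinct, $u_1$ and $u_2$ are adjacent to $v$, $u_1$ and $u_2$ have degree $1$, and $v$ has degree $3$. For indices $i_1,i_2,j\in\{1,\dots,n\}$ and a labelled tree $T_n$, let $\epsilon_{i_1,i_2,j}(T_n)=1$ if $(v_{i_1},v_{i_2},v_j)$ is a cherry in $T_n$ and $0$ otherwise. The number of cherries counts each cherry once, irrespective of the order of its two degree-one vertices: $$C_n(T_n) = \sum_{j=1}^n\ \sum_{\substack{1\le i_2<i_1\le n\\ i_1\ne j,\ i_2\neq j}} \epsilon_{i_1,i_2,j}(T_n).$$ *)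

theory Defs
  imports "HOL-Probability.Probability" "Graph_Theory.Digraph_Component"
begin

text \<open>
  A finite simple undirected graph is a \<^locale>\<open>pair_graph\<close>: a finite loop-free digraph whose
  arc relation is symmetric, each edge being represented by its two orientations.  The degree of a
  vertex is then its \<^const>\<open>out_degree\<close>, the number of its neighbours.

  In such a symmetric digraph every edge, traversed forth and back, is a
  \<^const>\<open>pre_digraph.cycle\<close> of length 2, so that the notion \<^const>\<open>Digraph_Component.tree\<close>
  (which forbids all directed cycles) is not the undirected one.  The cycles of the undirected
  graph are the directed cycles of length at least 3.
\<close>

definition undirected_tree :: "'a pair_pre_digraph \<Rightarrow> bool" where
  "undirected_tree G \<longleftrightarrow>
     pair_graph G \<and> Digraph_Component.connected (with_proj G) \<and>
     \<not> (\<exists>p. pre_digraph.cycle (with_proj G) p \<and> length p \<ge> 3)"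

text \<open>
  The vertex $v_i$ is represented by its index $i$.  For $n = 0$ there is no labelled tree, since
  connected graphs are nonempty.
\<close>

definition labelled_trees :: "nat \<Rightarrow> nat pair_pre_digraph set" where
  "labelled_trees n = {T. undirected_tree T \<and> pverts T = {1..n}}"

definition cherry :: "'a pair_pre_digraph \<Rightarrow> 'a \<Rightarrow> 'a \<Rightarrow> 'a \<Rightarrow> bool" where
  "cherry G u1 u2 v \<longleftrightarrow>
     u1 \<in> pverts G \<and> u2 \<in> pverts G \<and> v \<in> pverts G \<and> distinct [u1, u2, v] \<and>
     (u1, v) \<in> parcs G \<and> (u2, v) \<in> parcs G \<and>
     out_degree (with_proj G) u1 = 1 \<and> out_degree (with_proj G) u2 = 1 \<and>
     out_degree (with_proj G) v = 3"

definition cherry_indicator :: "nat \<Rightarrow> nat \<Rightarrow> nat \<Rightarrow> nat pair_pre_digraph \<Rightarrow> nat" where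
  "cherry_indicator i1 i2 j T = (if cherry T i1 i2 j then 1 else 0)"

definition num_cherries :: "nat \<Rightarrow> nat pair_pre_digraph \<Rightarrow> nat" where
  "num_cherries n T =
     (\<Sum>j=1..n. \<Sum>(i1, i2) \<in> {(i1, i2). 1 \<le> i2 \<and> i2 < i1 \<and> i1 \<le> n \<and> i1 \<noteq> j \<and> i2 \<noteq> j}.
        cherry_indicator i1 i2 j T)"

end

theory Submission
  imports Defs "HOL-Real_Asymp.Real_Asymp"
begin

text \<open>
  The proof compares the trees with at most one cherry to all trees by a switching argument.

  In any tree at least a third of the vertices have degree at most 2, because the degrees sum to
  less than twice the number of vertices.  Such a vertex can be suppressed: a leaf is deleted, and a
  vertex of degree 2 is replaced by an edge between its neighbours.  Conversely a suppressed vertex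
  can be put back in only linearly many ways, as a leaf at a vertex or in the middle of an edge.
  Linearly many choices against linearly many preimages: passing from a set of trees on $n$
  vertices to the results of suppressing one vertex after another, each recorded with the suppressed
  vertices, decreases the cardinality by at most a constant factor per vertex
  (\<open>card_low_degree\<close>, \<open>card_suppress_fibre\<close>, \<open>card_suppressions\<close>).

  Now start with the trees that have at most one cherry, suppress three vertices $u_1$, $u_2$, $v$,
  and put them back as a cherry: $v$ is attached at any of the other $n-3$ vertices, and $u_1$, $u_2$
  at $v$.  The outcome is a tree on the original vertices with a marked cherry, from which the
  suppressed tree and the place of the cherry can be read off.  Only a bounded number of
  neighbourhoods have changed, so the outcome has a bounded number of cherries
  (\<open>card_cherries_perturb\<close>), and each tree arises with a bounded number of marks.  The free choice
  of the place is thus a pure gain: the trees with at most one cherry, multiplied by $n-3$, number at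
  most a constant times all trees (\<open>few_cherries_rare\<close>).  Hence their proportion is at most a
  constant divided by $n-3$.
\<close>

section \<open>Trees as connected relations whose edges are bridges\<close>

text \<open>
  Acyclicity is expressed by saying that every edge is a bridge.  Unlike the absence of cycles this
  is a statement about reachability, so that the effect of a local change of the tree on it is
  found by mapping walks to walks, without ever handling paths or cycles explicitly.  It also
  excludes loops, since a vertex is always reachable from itself.
\<close>
definition tree_rel :: "'a set \<Rightarrow> ('a \<times> 'a) set \<Rightarrow> bool" where
  "tree_rel V E \<longleftrightarrow> finite V \<and> V \<noteq> {} \<and> E \<subseteq> V \<times> V \<and> sym E \<and>
     (\<forall>a\<in>V. \<forall>b\<in>V. (a, b) \<in> E\<^sup>*) \<and>
     (\<forall>a b. (a, b) \<in> E \<longrightarrow> (a, b) \<notin> (E - {(a, b), (b, a)})\<^sup>*)"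

lemma tree_relD:
  assumes "tree_rel V E"
  shows "finite V" "V \<noteq> {}" "E \<subseteq> V \<times> V" "sym E"
    and tree_rel_connected: "\<And>a b. a \<in> V \<Longrightarrow> b \<in> V \<Longrightarrow> (a, b) \<in> E\<^sup>*"
    and tree_rel_bridge: "\<And>a b. (a, b) \<in> E \<Longrightarrow> (a, b) \<notin> (E - {(a, b), (b, a)})\<^sup>*"
    and tree_rel_irrefl: "\<And>a. (a, a) \<notin> E"
    and tree_rel_sym: "\<And>a b. (a, b) \<in> E \<Longrightarrow> (b, a) \<in> E"
  using assms unfolding tree_rel_def sym_def by blast+

lemma tree_relI:
  assumes "finite V" "V \<noteq> {}" "E \<subseteq> V \<times> V" "sym E"
    and "\<And>a b. a \<in> V \<Longrightarrow> b \<in> V \<Longrightarrow> (a, b) \<in> E\<^sup>*"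
    and "\<And>a b. (a, b) \<in> E \<Longrightarrow> (a, b) \<notin> (E - {(a, b), (b, a)})\<^sup>*"
  shows "tree_rel V E"
  using assms unfolding tree_rel_def by blast

lemma tree_rel_finite: "tree_rel V E \<Longrightarrow> finite E"
  using tree_relD(1,3)[of V E] by (auto intro: finite_subset)

text \<open>
  The device for comparing two trees: a vertex map that sends edges of one to walks of the other
  transports reachability.
\<close>
lemma rtrancl_image_steps:
  assumes "(a, b) \<in> R\<^sup>*" and "\<And>p q. (p, q) \<in> R \<Longrightarrow> (f p, f q) \<in> S\<^sup>*"
  shows "(f a, f b) \<in> S\<^sup>*"
  using assms(1) by induction (auto intro: rtrancl_trans assms(2))

text \<open>
  If an edge $ab$ is not a bridge, a path from $a$ to $b$ avoiding it closes up with $ba$ to a cycle,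
  whose length is at least 3 because the path is not the single arc $(a,b)$.
\<close>
lemma undirected_tree_imp_tree_rel:
  assumes "undirected_tree G"
  shows "tree_rel (pverts G) (parcs G)"
proof -
  interpret pair_graph G using assms by (simp add: undirected_tree_def)
  have con: "Digraph_Component.connected (with_proj G)"
    and cyc: "\<And>p. cycle p \<Longrightarrow> length p < 3"
    using assms by (auto simp: undirected_tree_def not_le[symmetric])
  have sub: "parcs G \<subseteq> pverts G \<times> pverts G" using wellformed' by auto
  have sy: "sym (parcs G)" using arcs_symmetric by (auto simp: sym_def)
  have mk: "with_proj (mk_symmetric (with_proj G)) = with_proj G"
    using sy by (auto simp: mk_symmetric_def with_proj_def sym_def)
  have sc: "strongly_connected (with_proj G)"
    using con by (simp only: connected_def mk)
  have reach: "(a, b) \<in> (parcs G)\<^sup>*" if "a \<in> pverts G" "b \<in> pverts G" for a b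
    using sc that reachable_rtranclI[of "with_proj G" a b] by (simp add: strongly_connected_def)
  have ne: "pverts G \<noteq> {}" using sc by (simp add: strongly_connected_def)
  have bridge: "(a, b) \<notin> (parcs G - {(a, b), (b, a)})\<^sup>*" if ab: "(a, b) \<in> parcs G" for a b
  proof
    assume r: "(a, b) \<in> (parcs G - {(a, b), (b, a)})\<^sup>*"
    define H where "H = \<lparr>pverts = pverts G, parcs = parcs G - {(a, b), (b, a)}\<rparr>"
    interpret H: pair_wf_digraph H by unfold_locales (auto simp: H_def wellformed')
    have "a \<noteq> b" using ab no_loops' by auto
    have "a \<rightarrow>\<^sup>*\<^bsub>with_proj H\<^esub> b"
      using r wellformed'[OF ab] by (subst H.reachable_conv) (auto simp: H_def)
    then obtain p where p: "H.apath a p b" unfolding H.reachable_apath by blast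
    have ap: "apath a p b" and sp: "set p \<subseteq> parcs H"
      using p unfolding H.apath_def apath_def H.awalk_def awalk_def by (auto simp: H_def)
    have "awalk b ((b, a) # p) b"
      using ap ab by (auto simp: awalk_Cons_iff apath_def arcs_symmetric)
    then have "cycle ((b, a) # p)"
      unfolding cycle_def using ap by (auto simp: apath_def)
    then have "length ((b, a) # p) < 3" by (rule cyc)
    moreover have "p \<noteq> []" using \<open>a \<noteq> b\<close> ap by (auto simp: apath_def awalk_def)
    ultimately obtain e where e: "p = [e]" by (cases p) auto
    have "e = (a, b)" using ap by (cases e) (auto simp: e apath_def awalk_def)
    then show False using sp by (auto simp: e H_def)
  qed
  show ?thesis
    using pair_finite_verts ne sub sy reach bridge by (rule tree_relI)
qed

text \<open>
  Conversely, the first arc $(u,b)$ of a cycle of length at least 3 is not a bridge: the rest of the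
  cycle leads from $b$ back to $u$ without using that edge in either direction.  Using it forwards
  would visit $b$ twice, and using it backwards would make the cycle have length 2.
\<close>
lemma tree_rel_imp_undirected_tree:
  assumes "tree_rel (pverts G) (parcs G)"
  shows "undirected_tree G"
proof -
  note D = tree_relD[OF assms]
  interpret pair_graph G
    using D tree_rel_finite[OF assms]
    by unfold_locales (auto simp: symmetric_def)
  have mk: "with_proj (mk_symmetric (with_proj G)) = with_proj G"
    using D(4) by (auto simp: mk_symmetric_def with_proj_def sym_def)
  have "a \<rightarrow>\<^sup>*\<^bsub>with_proj G\<^esub> b" if "a \<in> pverts G" "b \<in> pverts G" for a b
    using D(5)[OF that] that by (auto simp: reachable_conv)
  then have "Digraph_Component.connected (with_proj G)"
    unfolding connected_def mk using D(2) by (auto simp: strongly_connected_def)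
  moreover have False if c: "cycle p" and l: "length p \<ge> 3" for p
  proof -
    obtain u where u: "awalk u p u" "distinct (tl (awalk_verts u p))"
      using c by (auto simp: cycle_def)
    obtain b q where p: "p = (u, b) # q" and q: "awalk b q u"
      using u(1) l by (cases p) (auto simp: awalk_Cons_iff)
    have ap: "apath b q u" using u(2) q by (simp add: apath_def p)
    have ub: "(u, b) \<in> parcs G" using u(1) by (auto simp: p awalk_Cons_iff)
    have 1: "(u, b) \<notin> set q"
    proof -
      have "awalk_verts b q = b # map snd q"
        using q by (induction q arbitrary: b) (auto simp: awalk_simps)
      then have "distinct (b # map snd q)" using ap by (simp add: apath_def)
      then show ?thesis by force
    qed
    have 2: "(b, u) \<notin> set q"
    proof
      assume "(b, u) \<in> set q"
      then obtain q1 q2 where qq: "q = q1 @ (b, u) # q2" by (meson split_list)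
      have "q1 = []" using ap
        by (cases q1) (auto simp: qq apath_append_iff apath_simps awalk_verts_conv)
      moreover have "q2 = []" using ap \<open>q1 = []\<close> apath_nonempty_ends[of u q2 u]
        by (auto simp: qq apath_simps)
      ultimately show False using l by (simp add: p qq)
    qed
    have "(b, u) \<in> (set q)\<^sup>*"
      using q
    proof (induction q arbitrary: b)
      case Nil then show ?case by (auto simp: awalk_Nil_iff)
    next
      case (Cons e es)
      have "(snd e, u) \<in> (set es)\<^sup>*" using Cons by (auto simp: awalk_Cons_iff)
      then have "(snd e, u) \<in> (set (e # es))\<^sup>*" by (rule rtrancl_mono[THEN subsetD, rotated]) auto
      moreover have "(b, snd e) \<in> set (e # es)" using Cons.prems by (auto simp: awalk_Cons_iff)
      ultimately show ?case by (rule converse_rtrancl_into_rtrancl[rotated])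
    qed
    moreover have "set q \<subseteq> parcs G - {(b, u), (u, b)}" using q 1 2 by (auto simp: awalk_def)
    ultimately have "(b, u) \<in> (parcs G - {(b, u), (u, b)})\<^sup>*" using rtrancl_mono by blast
    then show False using D(6)[of b u] D(8)[OF ub] by blast
  qed
  ultimately show ?thesis
    unfolding undirected_tree_def using pair_graph by blast
qed

section \<open>Suppressing a vertex and attaching a leaf\<close>

text \<open>
  Deletes $u$ and joins its neighbours to each other.  For a vertex of degree 1 this removes a leaf;
  for a vertex of degree 2 it replaces a path $x - u - y$ by the edge $xy$.
\<close>
definition suppress :: "'a \<Rightarrow> ('a \<times> 'a) set \<Rightarrow> ('a \<times> 'a) set" where
  "suppress u E = E \<inter> (- {u}) \<times> (- {u}) \<union> (E `` {u} \<times> E `` {u} - Id)"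

lemma tree_rel_no_triangle:
  assumes "tree_rel V E" "(u, x) \<in> E" "(u, y) \<in> E"
  shows "(x, y) \<notin> E"
proof
  assume xy: "(x, y) \<in> E"
  note D = tree_relD[OF assms(1)]
  have "x \<noteq> u" "y \<noteq> u" using D(7) assms by auto
  then have "(x, u) \<in> E - {(x, y), (y, x)}" "(u, y) \<in> E - {(x, y), (y, x)}"
    using assms D(8) by auto
  then have "(x, y) \<in> (E - {(x, y), (y, x)})\<^sup>*" by (meson rtrancl.simps)
  then show False using D(6)[OF xy] by blast
qed

lemma tree_rel_obtain_neighbour:
  assumes "tree_rel V E" "u \<in> V" "V \<noteq> {u}"
  obtains x where "(u, x) \<in> E"
proof -
  obtain w where "w \<in> V" "w \<noteq> u" using assms by blast
  then have "(u, w) \<in> E\<^sup>*" using tree_relD(5)[OF assms(1,2)] by blast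
  then show ?thesis using \<open>w \<noteq> u\<close> that by (cases rule: converse_rtranclE) auto
qed

lemma card_le_2_cover:
  assumes "card A \<le> 2" "finite A" "a \<in> A" "b \<in> A" "a \<noteq> b"
  shows "A = {a, b}"
  using assms by (metis card_2_iff card_seteq empty_subsetI insert_subset)

lemma tree_rel_suppress:
  assumes T: "tree_rel V E" and u: "u \<in> V" "V \<noteq> {u}" and deg: "card (E `` {u}) \<le> 2"
  shows "tree_rel (V - {u}) (suppress u E)"
proof -
  note D = tree_relD[OF T]
  have fN: "finite (E `` {u})" using tree_rel_finite[OF T] by (simp add: finite_Image)
  obtain x where x: "(u, x) \<in> E" using tree_rel_obtain_neighbour[OF T u] .
  have con: "(a, b) \<in> (suppress u E)\<^sup>*" if "a \<in> V - {u}" "b \<in> V - {u}" for a b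
  proof -
    \<comment> \<open>Contracting $u$ to its neighbour $x$ turns the walks of the old tree into walks of the new one.\<close>
    define f where "f = (\<lambda>p. if p = u then x else p)"
    have "(f p, f q) \<in> (suppress u E)\<^sup>*" if "(p, q) \<in> E" for p q
    proof (cases "f p = f q")
      case False
      then have "(f p, f q) \<in> suppress u E"
        using that x D(7,8) by (auto simp: f_def suppress_def split: if_splits)
      then show ?thesis by blast
    qed auto
    then have "(f a, f b) \<in> (suppress u E)\<^sup>*"
      using D(5) that by (intro rtrancl_image_steps[of a b E f]) auto
    then show ?thesis using that by (simp add: f_def)
  qed
  have bridge: False
    if ab: "(a, b) \<in> suppress u E" and r: "(a, b) \<in> (suppress u E - {(a, b), (b, a)})\<^sup>*" for a b
  proof (cases "(a, b) \<in> E")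
    case True
    have nu: "a \<noteq> u" "b \<noteq> u" using ab D(7) by (auto simp: suppress_def)
    \<comment> \<open>An old edge $ab$ remains a bridge: a new edge $pq$ of a walk can be replaced by $p - u - q$.\<close>
    have "(p, q) \<in> (E - {(a, b), (b, a)})\<^sup>*" if "(p, q) \<in> suppress u E - {(a, b), (b, a)}" for p q
    proof (cases "(p, q) \<in> E")
      case False
      then have "(u, p) \<in> E" "(u, q) \<in> E" using that by (auto simp: suppress_def)
      then have "(p, u) \<in> E - {(a, b), (b, a)}" "(u, q) \<in> E - {(a, b), (b, a)}"
        using D(8) nu by auto
      then show ?thesis by (meson rtrancl.simps)
    qed (use that in auto)
    then have "(a, b) \<in> (E - {(a, b), (b, a)})\<^sup>*"
      using rtrancl_image_steps[OF r, of "\<lambda>p. p"] by blast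
    then show False using D(6)[OF True] by blast
  next
    case False
    then have n: "(u, a) \<in> E" "(u, b) \<in> E" "a \<noteq> b" using ab by (auto simp: suppress_def)
    \<comment> \<open>The new edge $ab$ is a bridge: going from $a$ to $b$ without it and then to $u$ would
      avoid the old edge $au$.\<close>
    have N: "E `` {u} = {a, b}" using card_le_2_cover[OF deg fN] n by auto
    have nu: "a \<noteq> u" "b \<noteq> u" using n D(7) by auto
    have "suppress u E - {(a, b), (b, a)} \<subseteq> E - {(a, u), (u, a)}"
      using N nu by (auto simp: suppress_def)
    then have "(a, b) \<in> (E - {(a, u), (u, a)})\<^sup>*" using r rtrancl_mono by blast
    moreover have "(b, u) \<in> E - {(a, u), (u, a)}" using n D(8) nu by auto
    ultimately have "(a, u) \<in> (E - {(a, u), (u, a)})\<^sup>*" by (rule rtrancl_into_rtrancl)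
    then show False using D(6)[of a u] D(8) n by blast
  qed
  have "x \<noteq> u" "x \<in> V" using x D(3,7) by auto
  then have "V - {u} \<noteq> {}" by auto
  moreover have "suppress u E \<subseteq> (V - {u}) \<times> (V - {u})"
    using D(3,7) by (auto simp: suppress_def)
  moreover have "sym (suppress u E)" using D(8) by (auto simp: suppress_def sym_def)
  ultimately show ?thesis using D(1) con bridge by (intro tree_relI) auto
qed

definition add_leaf :: "'a \<Rightarrow> 'a \<Rightarrow> ('a \<times> 'a) set \<Rightarrow> ('a \<times> 'a) set" where
  "add_leaf u x E = insert (u, x) (insert (x, u) E)"

lemma tree_rel_add_leaf:
  assumes T: "tree_rel V E" and u: "u \<notin> V" and x: "x \<in> V"
  shows "tree_rel (insert u V) (add_leaf u x E)"
proof -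
  note D = tree_relD[OF T]
  have ux: "u \<noteq> x" using u x by auto
  have nE: "(p, u) \<notin> E" "(u, p) \<notin> E" for p using D(3) u by auto
  have sub: "E\<^sup>* \<subseteq> (add_leaf u x E)\<^sup>*" by (rule rtrancl_mono) (auto simp: add_leaf_def)
  have 1: "(u, x) \<in> (add_leaf u x E)\<^sup>*" "(x, u) \<in> (add_leaf u x E)\<^sup>*"
    by (auto simp: add_leaf_def)
  have "(a, x) \<in> (add_leaf u x E)\<^sup>* \<and> (x, a) \<in> (add_leaf u x E)\<^sup>*" if "a \<in> insert u V" for a
    using that 1 sub D(5)[OF _ x] D(5)[OF x] by blast
  then have con: "(a, b) \<in> (add_leaf u x E)\<^sup>*" if "a \<in> insert u V" "b \<in> insert u V" for a b
    using that by (meson rtrancl_trans)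
  \<comment> \<open>Without its only edge, $u$ is isolated.\<close>
  have iso: "(p, q) \<notin> (add_leaf u x E - {(u, x), (x, u)})\<^sup>*" if "p \<noteq> q" "p = u \<or> q = u" for p q
  proof
    assume "(p, q) \<in> (add_leaf u x E - {(u, x), (x, u)})\<^sup>*"
    moreover have "(u, r) \<notin> add_leaf u x E - {(u, x), (x, u)}"
      "(r, u) \<notin> add_leaf u x E - {(u, x), (x, u)}" for r
      using nE by (auto simp: add_leaf_def)
    ultimately show False using that by (metis converse_rtranclE rtranclE)
  qed
  have bridge: False
    if ab: "(a, b) \<in> add_leaf u x E" and r: "(a, b) \<in> (add_leaf u x E - {(a, b), (b, a)})\<^sup>*" for a b
  proof (cases "(a, b) \<in> E")
    case True
    \<comment> \<open>An old edge $ab$ remains a bridge, because $u$ can be contracted to $x$ in a walk avoiding $ab$.\<close>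
    define f where "f = (\<lambda>p. if p = u then x else p)"
    have "(f p, f q) \<in> (E - {(a, b), (b, a)})\<^sup>*"
      if "(p, q) \<in> add_leaf u x E - {(a, b), (b, a)}" for p q
    proof -
      have "(f p, f q) \<in> E - {(a, b), (b, a)} \<or> f p = f q"
        using that nE ux by (auto simp: f_def add_leaf_def)
      then show ?thesis by auto
    qed
    then have "(f a, f b) \<in> (E - {(a, b), (b, a)})\<^sup>*"
      by (rule rtrancl_image_steps[OF r])
    moreover have "f a = a" "f b = b" using True nE by (auto simp: f_def)
    ultimately show False using D(6)[OF True] by simp
  next
    case False
    then have "(a, b) = (u, x) \<or> (a, b) = (x, u)" using ab by (auto simp: add_leaf_def)
    then show False using r iso[of a b] ux by (auto simp: insert_commute)
  qed
  have "add_leaf u x E \<subseteq> insert u V \<times> insert u V" using D(3) x by (auto simp: add_leaf_def)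
  moreover have "sym (add_leaf u x E)" using D(4) by (auto simp: add_leaf_def sym_def)
  ultimately show ?thesis using D(1) con bridge by (intro tree_relI) auto
qed

lemma tree_rel_singleton: "tree_rel {v} {}"
  by (auto simp: tree_rel_def sym_def)

lemma tree_rel_exists:
  assumes "finite V" "V \<noteq> {}"
  shows "\<exists>E. tree_rel V E"
  using assms
proof (induction V rule: finite_ne_induct)
  case (singleton x) show ?case by (rule exI[of _ "{}"], rule tree_rel_singleton)
next
  case (insert x F)
  then obtain E y where "tree_rel F E" "y \<in> F" by blast
  then have "tree_rel (insert x F) (add_leaf x y E)" using insert.hyps by (intro tree_rel_add_leaf)
  then show ?case ..
qed

section \<open>Edges and degrees\<close>

text \<open>
  Grow a subtree one vertex at a time.  A vertex outside the connected set $W$ has at most one edge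
  into $W$, since a second one would close a cycle; hence each step adds exactly one edge, that is
  two arcs.
\<close>
lemma tree_rel_grow_subtree:
  assumes T: "tree_rel V E" and k: "1 \<le> k" "k \<le> card V"
  shows "\<exists>W \<subseteq> V. card W = k \<and> (\<forall>a\<in>W. \<forall>b\<in>W. (a, b) \<in> (E \<inter> W \<times> W)\<^sup>*) \<and>
           card (E \<inter> W \<times> W) \<le> 2 * k"
  using k
proof (induction k rule: dec_induct)
  case base
  obtain v where "v \<in> V" using tree_relD(2)[OF T] by blast
  moreover have "E \<inter> {v} \<times> {v} = {}" using tree_relD(7)[OF T] by auto
  ultimately show ?case by (intro exI[of _ "{v}"]) auto
next
  case (step k)
  note D = tree_relD[OF T]
  obtain W where W: "W \<subseteq> V" "card W = k" "card (E \<inter> W \<times> W) \<le> 2 * k"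
    and con: "\<And>a b. a \<in> W \<Longrightarrow> b \<in> W \<Longrightarrow> (a, b) \<in> (E \<inter> W \<times> W)\<^sup>*"
    using step by auto
  have fW: "finite W" using W(1) D(1) finite_subset by blast
  obtain r where r: "r \<in> W" using W(2) step.hyps by (metis all_not_in_conv card.empty not_one_le_zero)
  obtain z where z: "z \<in> V" "z \<notin> W" using W(1,2) step.prems by (metis Suc_n_not_le_n subsetI subset_antisym)
  have "\<exists>w u. w \<in> W \<and> u \<notin> W \<and> (w, u) \<in> E"
  proof (rule ccontr)
    assume "\<not> ?thesis"
    then have "E `` W \<subseteq> W" by auto
    then have "E\<^sup>* `` W = W" by (rule Image_closed_trancl)
    then show False using D(5)[of r z] r z W(1) by blast
  qed
  then obtain w u where wu: "w \<in> W" "u \<notin> W" "(w, u) \<in> E" by blast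
  have only: "w' = w" if "w' \<in> W" "(w', u) \<in> E" for w'
  proof (rule ccontr)
    assume ne: "w' \<noteq> w"
    have "E \<inter> W \<times> W \<subseteq> E - {(w, u), (u, w)}" using wu by auto
    then have "(w, w') \<in> (E - {(w, u), (u, w)})\<^sup>*" using con[OF wu(1) that(1)] rtrancl_mono by blast
    moreover have "(w', u) \<in> E - {(w, u), (u, w)}" using that ne wu by auto
    ultimately have "(w, u) \<in> (E - {(w, u), (u, w)})\<^sup>*" by (rule rtrancl_into_rtrancl)
    then show False using D(6)[OF wu(3)] by blast
  qed
  let ?W = "insert u W"
  have new: "E \<inter> ?W \<times> ?W = add_leaf u w (E \<inter> W \<times> W)"
  proof (intro equalityI subrelI)
    fix p q assume pq: "(p, q) \<in> E \<inter> ?W \<times> ?W"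
    then have "(q, p) \<in> E" "(p, q) \<noteq> (u, u)" using D(7,8) by auto
    then consider "p \<in> W" "q \<in> W" | "p = u" "q \<in> W" | "q = u" "p \<in> W" using pq by auto
    then show "(p, q) \<in> add_leaf u w (E \<inter> W \<times> W)"
      using only[of p] only[of q] pq \<open>(q, p) \<in> E\<close> by cases (auto simp: add_leaf_def)
  next
    fix p q assume "(p, q) \<in> add_leaf u w (E \<inter> W \<times> W)"
    then show "(p, q) \<in> E \<inter> ?W \<times> ?W"
      using wu D(8)[OF wu(3)] by (auto simp: add_leaf_def)
  qed
  have "card (E \<inter> ?W \<times> ?W) \<le> 2 * Suc k"
  proof -
    have "card (insert e (insert e' F)) \<le> card F + 2" if "finite F" for e e' and F :: "('a \<times> 'a) set"
      using that by (simp add: card_insert_if)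
    from this[of "E \<inter> W \<times> W" "(u, w)" "(w, u)"] show ?thesis
      unfolding new add_leaf_def using W(3) tree_rel_finite[OF T] by simp
  qed
  moreover have "(a, b) \<in> (E \<inter> ?W \<times> ?W)\<^sup>*" if "a \<in> ?W" "b \<in> ?W" for a b
  proof -
    have sub: "(E \<inter> W \<times> W)\<^sup>* \<subseteq> (E \<inter> ?W \<times> ?W)\<^sup>*" by (rule rtrancl_mono) auto
    have "(w, u) \<in> (E \<inter> ?W \<times> ?W)\<^sup>*" "(u, w) \<in> (E \<inter> ?W \<times> ?W)\<^sup>*" using new by (auto simp: add_leaf_def)
    then have "(a, w) \<in> (E \<inter> ?W \<times> ?W)\<^sup>* \<and> (w, a) \<in> (E \<inter> ?W \<times> ?W)\<^sup>*" if "a \<in> ?W" for a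
      using that sub con wu(1) by blast
    then show ?thesis using that by (meson rtrancl_trans)
  qed
  moreover have "?W \<subseteq> V" "card ?W = Suc k" using W wu D(3) fW by auto
  ultimately show ?case by blast
qed

lemma tree_rel_card_arcs:
  assumes "tree_rel V E"
  shows "card E \<le> 2 * card V"
proof -
  note D = tree_relD[OF assms]
  have "1 \<le> card V" using D(1,2) by (simp add: Suc_leI card_gt_0_iff)
  then obtain W where "W \<subseteq> V" "card W = card V" "card (E \<inter> W \<times> W) \<le> 2 * card V"
    using tree_rel_grow_subtree[OF assms] by blast
  moreover then have "W = V" using D(1) card_subset_eq by blast
  ultimately show ?thesis using D(3) by (simp add: Int_absorb2)
qed

text \<open>
  The degrees sum to at most twice the number of vertices, so at most two thirds of the vertices can
  have degree 3 or more.
\<close>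
lemma card_low_degree:
  assumes T: "tree_rel V E"
  shows "card V \<le> 3 * card {u \<in> V. card (E `` {u}) \<le> 2}"
proof -
  note D = tree_relD[OF T]
  let ?L = "{u \<in> V. card (E `` {u}) \<le> 2}" and ?H = "{u \<in> V. 3 \<le> card (E `` {u})}"
  have fin: "finite (E `` {u})" for u using tree_rel_finite[OF T] by (simp add: finite_Image)
  have "E = (SIGMA u:V. E `` {u})" using D(3) by auto
  then have "card E = (\<Sum>u\<in>V. card (E `` {u}))"
    using card_SigmaI[of V "\<lambda>u. E `` {u}"] D(1) fin by auto
  moreover have "(\<Sum>u\<in>?H. 3) \<le> (\<Sum>u\<in>?H. card (E `` {u}))" by (rule sum_mono) auto
  moreover have "(\<Sum>u\<in>?H. card (E `` {u})) \<le> (\<Sum>u\<in>V. card (E `` {u}))"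
    by (rule sum_mono2) (use D(1) in auto)
  moreover have "card V = card ?L + card ?H"
    using D(1) by (subst card_Un_disjoint[symmetric]) (auto intro!: arg_cong[of _ _ card])
  ultimately show ?thesis using tree_rel_card_arcs[OF T] by simp
qed

section \<open>Counting suppressions\<close>

text \<open>
  Undoing a suppression means choosing the neighbourhood of the new vertex $u$: either a single
  vertex, or the two ends of an edge, on which $u$ is then placed.  A tree has only linearly many
  vertices and edges to choose from.
\<close>
lemma card_suppress_fibre:
  assumes "finite V" "u \<in> V" "V \<noteq> {u}"
  shows "card {E. tree_rel V E \<and> card (E `` {u}) \<le> 2 \<and> suppress u E = S} \<le> 3 * card V"
    (is "card ?F \<le> _")
proof (cases "?F = {}")
  case False
  then obtain E0 where "E0 \<in> ?F" unfolding ex_in_conv[symmetric] ..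
  then have "tree_rel V E0" "card (E0 `` {u}) \<le> 2" "suppress u E0 = S" by simp_all
  then have tS: "tree_rel (V - {u}) S" using tree_rel_suppress[of V E0 u] assms by blast
  \<comment> \<open>The inverse of suppression, given the neighbourhood $N$ of $u$.  Subtracting \<open>N \<times> N\<close> removes
    the edge that suppression has added, and nothing else, as a tree has no triangles.\<close>
  define restore where "restore N = S - N \<times> N \<union> {u} \<times> N \<union> N \<times> {u}" for N
  let ?Ns = "(\<lambda>x. {x}) ` (V - {u}) \<union> (\<lambda>(x, y). {x, y}) ` S"
  have fS: "finite S" by (rule tree_rel_finite[OF tS])
  have "?F \<subseteq> restore ` ?Ns"
  proof
    fix E assume "E \<in> ?F"
    then have E: "tree_rel V E" "card (E `` {u}) \<le> 2" "suppress u E = S" by auto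
    note D = tree_relD[OF E(1)]
    have fN: "finite (E `` {u})" using tree_rel_finite[OF E(1)] by (simp add: finite_Image)
    obtain x where x: "(u, x) \<in> E" using tree_rel_obtain_neighbour[OF E(1) assms(2,3)] .
    have sy: "(p, u) \<in> E \<longleftrightarrow> (u, p) \<in> E" for p using D(8) by blast
    have tri: "(u, p) \<in> E \<Longrightarrow> (u, q) \<in> E \<Longrightarrow> (p, q) \<notin> E" for p q
      using tree_rel_no_triangle[OF E(1)] by blast
    have "(p, q) \<in> E \<longleftrightarrow> (p, q) \<in> restore (E `` {u})" for p q
      unfolding restore_def E(3)[symmetric] suppress_def
      using D(7)[of u] tri[of p q] sy[of p] by auto
    then have "E = restore (E `` {u})" by (simp add: set_eq_iff)
    moreover have "E `` {u} \<in> ?Ns"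
    proof (cases "E `` {u} = {x}")
      case True then show ?thesis using x D(3,7) by auto
    next
      case False
      then obtain y where y: "(u, y) \<in> E" "x \<noteq> y" using x by auto
      then have "E `` {u} = {x, y}" using card_le_2_cover[OF E(2) fN] x by auto
      moreover have "(x, y) \<in> S" unfolding E(3)[symmetric] suppress_def using x y by auto
      then have "{x, y} \<in> (\<lambda>(x, y). {x, y}) ` S" by (rule rev_image_eqI) simp
      ultimately show ?thesis by simp
    qed
    ultimately show "E \<in> restore ` ?Ns" by (rule image_eqI)
  qed
  then have "card ?F \<le> card ?Ns"
    using assms(1) fS surj_card_le[of ?Ns ?F restore] by simp
  also have "\<dots> \<le> card ((\<lambda>x. {x}) ` (V - {u})) + card ((\<lambda>(x, y). {x, y}) ` S)" by (rule card_Un_le)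
  also have "\<dots> \<le> card (V - {u}) + card S"
    using assms(1) fS by (intro add_mono card_image_le) auto
  also have "\<dots> \<le> card (V - {u}) + 2 * card (V - {u})" using tree_rel_card_arcs[OF tS] by simp
  also have "\<dots> \<le> 3 * card V" using assms(1) by (simp add: card_Diff_subset_Int)
  finally show ?thesis .
next
  case True
  show ?thesis unfolding True by simp
qed

text \<open>
  A state is a tree together with the list of the vertices suppressed so far, so that the tree lives
  on \<open>V - set us\<close>; a step performs every possible further suppression.
\<close>
definition suppress_step :: "'a set \<Rightarrow> (('a \<times> 'a) set \<times> 'a list) set \<Rightarrow> (('a \<times> 'a) set \<times> 'a list) set" where
  "suppress_step V A = (\<lambda>((E, us), u). (suppress u E, u # us)) `
     (SIGMA (E, us):A. {u \<in> V - set us. card (E `` {u}) \<le> 2})"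

lemma card_le_fibre_times_image:
  assumes "finite P" "\<And>y. y \<in> f ` P \<Longrightarrow> card {p \<in> P. f p = y} \<le> k"
  shows "card P \<le> k * card (f ` P)"
proof -
  have "card P = (\<Sum>y\<in>f ` P. card {p \<in> P. f p = y})"
    using sum.image_gen[OF assms(1), of "\<lambda>_. 1::nat" f] by simp
  also have "\<dots> \<le> (\<Sum>y\<in>f ` P. k)" using assms(2) by (rule sum_mono)
  finally show ?thesis by (simp add: mult.commute)
qed

text \<open>
  On $m$ vertices there are at least $m/3$ vertices to suppress, and at most $3m$ trees give the same
  result for the same suppressed vertex.  So a step loses only a constant factor: there are fewer
  trees on fewer vertices, but the recorded vertices compensate for that.
\<close>
lemma card_suppress_step:
  assumes V: "finite V" "k + 1 < card V" and fA: "finite A"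
    and A: "\<And>E us. (E, us) \<in> A \<Longrightarrow>
              length us = k \<and> distinct us \<and> set us \<subseteq> V \<and> tree_rel (V - set us) E"
  shows "card A \<le> 9 * card (suppress_step V A)"
proof -
  define m where "m = card V - k"
  have m: "card (V - set us) = m" if "(E, us) \<in> A" for E us
    using A[OF that] V(1) by (simp add: m_def card_Diff_subset distinct_card)
  have m2: "m \<ge> 2" using V(2) by (simp add: m_def)
  define L where "L = (\<lambda>(E :: ('a \<times> 'a) set, us). {u \<in> V - set us. card (E `` {u}) \<le> 2})"
  define f where "f = (\<lambda>((E, us), u). (suppress u E, u # us) :: ('a \<times> 'a) set \<times> 'a list)"
  let ?P = "Sigma A L"
  have finL: "finite (L a)" for a using V(1) by (auto simp: L_def split: prod.splits)
  then have finP: "finite ?P" using fA by auto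
  have img: "f ` ?P = suppress_step V A"
    unfolding suppress_step_def f_def L_def ..
  have "m \<le> 3 * card (L a)" if "a \<in> A" for a
  proof -
    obtain E us where a: "a = (E, us)" by (cases a)
    have "tree_rel (V - set us) E" using A that a by auto
    then show ?thesis using card_low_degree m[of E us] that by (fastforce simp: a L_def)
  qed
  then have "(\<Sum>a\<in>A. m) \<le> (\<Sum>a\<in>A. 3 * card (L a))" by (rule sum_mono)
  then have 1: "m * card A \<le> 3 * card ?P"
    using fA finL by (simp add: card_SigmaI sum_distrib_left mult.commute)
  have "card {p \<in> ?P. f p = y} \<le> 3 * m" if "y \<in> f ` ?P" for y
  proof -
    obtain E0 us u where p: "(E0, us) \<in> A" "u \<in> L (E0, us)" "y = (suppress u E0, u # us)"
      using \<open>y \<in> f ` ?P\<close> by (auto simp: f_def)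
    let ?W = "V - set us" and ?S = "suppress u E0"
    let ?F = "{E. tree_rel ?W E \<and> card (E `` {u}) \<le> 2 \<and> suppress u E = ?S}"
    have "{p \<in> ?P. f p = y} \<subseteq> (\<lambda>E. ((E, us), u)) ` ?F"
    proof
      fix z assume z: "z \<in> {p \<in> ?P. f p = y}"
      obtain E us' u' where "z = ((E, us'), u')" by (metis surj_pair)
      with z have "z = ((E, us), u)" "(E, us) \<in> A" "card (E `` {u}) \<le> 2" "suppress u E = ?S"
        by (auto simp: f_def p(3) L_def)
      then show "z \<in> (\<lambda>E. ((E, us), u)) ` ?F" using A by blast
    qed
    moreover have "?F \<subseteq> Pow (?W \<times> ?W)" using tree_relD(3) by blast
    then have "finite ?F" by (rule finite_subset) (use V(1) in auto)
    ultimately have "card {p \<in> ?P. f p = y} \<le> card ?F" by (rule surj_card_le[rotated])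
    also have "\<dots> \<le> 3 * card ?W"
    proof (rule card_suppress_fibre)
      show "?W \<noteq> {u}" using m[OF p(1)] m2 by auto
    qed (use V(1) p(2) in \<open>auto simp: L_def\<close>)
    finally show ?thesis using m[OF p(1)] by simp
  qed
  then have "card ?P \<le> 3 * m * card (f ` ?P)" by (rule card_le_fibre_times_image[OF finP])
  then have "3 * card ?P \<le> 3 * (3 * m * card (f ` ?P))" by (rule mult_le_mono2)
  with 1 have "m * card A \<le> 3 * (3 * m * card (f ` ?P))" by (rule order_trans)
  also have "\<dots> = m * (9 * card (suppress_step V A))" by (simp add: img)
  finally show ?thesis using m2 by simp
qed

definition suppressions :: "'a set \<Rightarrow> ('a \<times> 'a) set set \<Rightarrow> nat \<Rightarrow> (('a \<times> 'a) set \<times> 'a list) set" where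
  "suppressions V B k = (suppress_step V ^^ k) ((\<lambda>E. (E, [])) ` B)"

lemma suppressions_simps:
  "suppressions V B 0 = (\<lambda>E. (E, [])) ` B"
  "suppressions V B (Suc k) = suppress_step V (suppressions V B k)"
  by (simp_all add: suppressions_def)

lemma suppress_neighbours:
  assumes "sym E" "p \<noteq> u" "p \<notin> E `` {u}"
  shows "suppress u E `` {p} = E `` {p}"
proof -
  have "(p, u) \<notin> E" using assms by (auto dest: symD)
  then show ?thesis using assms(2,3) by (auto simp: suppress_def)
qed

text \<open>
  Each suppression changes the neighbourhoods of at most three vertices: the suppressed one and its
  at most two neighbours.  The set \<open>C\<close> collects them.
\<close>
lemma suppressions_invariant:
  assumes B: "\<And>E. E \<in> B \<Longrightarrow> tree_rel V E"
    and "k < card V" "(E, us) \<in> suppressions V B k"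
  shows "length us = k \<and> distinct us \<and> set us \<subseteq> V \<and> tree_rel (V - set us) E \<and>
     (\<exists>T\<in>B. \<exists>C. finite C \<and> card C \<le> 3 * k \<and> set us \<subseteq> C \<and> (\<forall>p. p \<notin> C \<longrightarrow> E `` {p} = T `` {p}))"
  using assms(2,3)
proof (induction k arbitrary: E us)
  case 0
  then obtain "us = []" "E \<in> B" by (auto simp: suppressions_simps)
  moreover have "\<exists>C::'a set. finite C \<and> card C \<le> 3 * 0 \<and> set [] \<subseteq> C \<and> (\<forall>p. p \<notin> C \<longrightarrow> E `` {p} = E `` {p})"
    by (rule exI[of _ "{}"]) simp
  ultimately show ?case using B by auto
next
  case (Suc k)
  obtain F vs u where u: "E = suppress u F" "us = u # vs" "(F, vs) \<in> suppressions V B k"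
      "u \<in> V - set vs" "card (F `` {u}) \<le> 2"
    using Suc.prems(2) by (auto simp: suppressions_simps suppress_step_def)
  have IH: "length vs = k" "distinct vs" "set vs \<subseteq> V" "tree_rel (V - set vs) F"
    using Suc.IH[OF _ u(3)] Suc.prems(1) by simp_all
  obtain T C where C: "T \<in> B" "finite C" "card C \<le> 3 * k" "set vs \<subseteq> C"
      "\<And>p. p \<notin> C \<Longrightarrow> F `` {p} = T `` {p}"
    using Suc.IH[OF _ u(3)] Suc.prems(1) by auto
  have "finite V" using tree_relD(1)[OF B[OF C(1)]] .
  have "card (V - set vs) = card V - k"
    using IH \<open>finite V\<close> by (simp add: card_Diff_subset distinct_card)
  then have "V - set vs \<noteq> {u}" using Suc.prems(1) by auto
  then have "tree_rel (V - set vs - {u}) E"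
    unfolding u(1) using tree_rel_suppress[OF IH(4)] u by blast
  moreover have "V - set vs - {u} = V - set us" using u(2) by auto
  ultimately have 1: "tree_rel (V - set us) E" by simp
  define C' where "C' = insert u (F `` {u} \<union> C)"
  have fF: "finite (F `` {u})" using tree_rel_finite[OF IH(4)] by (simp add: finite_Image)
  have "card C' \<le> Suc (card (F `` {u} \<union> C))" unfolding C'_def by (rule card_insert_le_m1) simp_all
  also have "\<dots> \<le> Suc (card (F `` {u}) + card C)" using card_Un_le by auto
  also have "\<dots> \<le> 3 * Suc k" using u(5) C(3) by simp
  finally have 2: "card C' \<le> 3 * Suc k" .
  have 3: "E `` {p} = T `` {p}" if "p \<notin> C'" for p
    using that C(5)[of p] suppress_neighbours[of F p u] tree_relD(4)[OF IH(4)] by (simp add: C'_def u(1))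
  have "finite C'" "set us \<subseteq> C'" using C fF u(2) by (auto simp: C'_def)
  with 2 3 C(1) have "\<exists>T\<in>B. \<exists>C. finite C \<and> card C \<le> 3 * Suc k \<and> set us \<subseteq> C \<and> (\<forall>p. p \<notin> C \<longrightarrow> E `` {p} = T `` {p})"
    by blast
  then show ?case using 1 IH u by simp
qed

lemma finite_suppressions:
  assumes "finite V" "finite B"
  shows "finite (suppressions V B k)"
proof (induction k)
  case 0 show ?case using assms by (simp add: suppressions_simps)
next
  case (Suc k)
  have "suppress_step V (suppressions V B k)
      \<subseteq> (\<lambda>((E, us), u). (suppress u E, u # us)) ` (suppressions V B k \<times> V)"
    unfolding suppress_step_def by (rule image_mono) auto
  then show ?case using Suc assms(1) by (auto simp: suppressions_simps intro: finite_subset)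
qed

lemma card_suppressions:
  assumes "finite V" "finite B" "\<And>E. E \<in> B \<Longrightarrow> tree_rel V E" "k < card V"
  shows "card B \<le> 9 ^ k * card (suppressions V B k)"
  using assms(4)
proof (induction k)
  case 0 show ?case by (simp add: suppressions_simps card_image inj_on_def)
next
  case (Suc k)
  have "card (suppressions V B k) \<le> 9 * card (suppress_step V (suppressions V B k))"
    using suppressions_invariant[of B V k] assms Suc.prems
    by (intro card_suppress_step[of V k] finite_suppressions) auto
  then have "9 ^ k * card (suppressions V B k)
      \<le> 9 ^ k * (9 * card (suppress_step V (suppressions V B k)))" by (rule mult_le_mono2)
  moreover have "card B \<le> 9 ^ k * card (suppressions V B k)" using Suc by simp
  ultimately have "card B \<le> 9 ^ k * (9 * card (suppress_step V (suppressions V B k)))"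
    by (rule order_trans[rotated])
  then show ?case by (simp add: suppressions_simps mult.assoc mult.left_commute)
qed

section \<open>Cherries\<close>

text \<open>
  Ordered cherries: each cherry of the tree occurs twice, once for each order of its two leaves.
\<close>
definition cherries :: "('a \<times> 'a) set \<Rightarrow> ('a \<times> 'a \<times> 'a) set" where
  "cherries E = {(a, b, c). a \<noteq> b \<and> (a, c) \<in> E \<and> (b, c) \<in> E \<and>
     card (E `` {a}) = 1 \<and> card (E `` {b}) = 1 \<and> card (E `` {c}) = 3}"

lemma finite_cherries: "finite E \<Longrightarrow> finite (cherries E)"
proof -
  assume "finite E"
  have "cherries E \<subseteq> Field E \<times> Field E \<times> Field E" by (auto simp: cherries_def Field_def)
  moreover have "finite (Field E)" using \<open>finite E\<close> by (rule finite_Field)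
  ultimately show ?thesis by (meson finite_SigmaI finite_subset)
qed

text \<open>
  Whether $(a,b,c)$ is a cherry depends only on the neighbourhoods of $a$, $b$ and $c$.  A cherry of
  \<open>E\<close> that is not one of \<open>F\<close> thus involves a vertex of \<open>C\<close>, and its centre $c$ lies in \<open>C\<close> or is the
  unique neighbour of a leaf in \<open>C\<close>.  This leaves at most \<open>2 * card C\<close> centres, each with at most
  nine choices for the two leaves.
\<close>
lemma card_cherries_perturb:
  assumes E: "sym E" "finite E" and F: "sym F" "finite F" and C: "finite C"
    and same: "\<And>p. p \<notin> C \<Longrightarrow> E `` {p} = F `` {p}"
  shows "card (cherries E) \<le> card (cherries F) + 18 * card C"
proof -
  define D where "D = C \<union> (\<Union>a\<in>{a \<in> C. card (E `` {a}) = 1}. E `` {a})"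
  define X where "X = (SIGMA c:{c \<in> D. card (E `` {c}) = 3}. E `` {c} \<times> E `` {c})"
  have fin: "finite (E `` A)" for A using E(2) by (simp add: finite_Image)
  have finD: "finite D" using C fin by (auto simp: D_def)
  have "card (\<Union>a\<in>{a \<in> C. card (E `` {a}) = 1}. E `` {a}) \<le> (\<Sum>a\<in>{a \<in> C. card (E `` {a}) = 1}. card (E `` {a}))"
    using C by (intro card_UN_le) auto
  also have "\<dots> \<le> card C" using C by (simp add: card_mono)
  finally have "card (\<Union>a\<in>{a \<in> C. card (E `` {a}) = 1}. E `` {a}) \<le> card C" .
  then have cD: "card D \<le> 2 * card C"
    using card_Un_le[of C "\<Union>a\<in>{a \<in> C. card (E `` {a}) = 1}. E `` {a}"] unfolding D_def by linarith
  have "card X = (\<Sum>c\<in>{c \<in> D. card (E `` {c}) = 3}. card (E `` {c} \<times> E `` {c}))"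
    unfolding X_def using finD fin by (intro card_SigmaI) auto
  also have "\<dots> = 9 * card {c \<in> D. card (E `` {c}) = 3}" by (simp add: card_cartesian_product)
  also have "\<dots> \<le> 9 * card D" using finD by (simp add: card_mono)
  finally have cX: "card X \<le> 18 * card C" using cD by simp
  have finX: "finite X" unfolding X_def using finD fin by (intro finite_SigmaI) auto
  have "cherries E \<subseteq> cherries F \<union> (\<lambda>(c, a, b). (a, b, c)) ` X"
  proof
    fix t assume t: "t \<in> cherries E"
    obtain a b c where abc: "t = (a, b, c)" by (metis surj_pair)
    have ch: "a \<noteq> b" "(a, c) \<in> E" "(b, c) \<in> E" "card (E `` {a}) = 1" "card (E `` {b}) = 1"
        "card (E `` {c}) = 3" using t by (auto simp: abc cherries_def)
    show "t \<in> cherries F \<union> (\<lambda>(c, a, b). (a, b, c)) ` X"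
    proof (cases "c \<in> D")
      case True
      have "(c, a) \<in> E" "(c, b) \<in> E" using ch E(1) by (auto dest: symD)
      then have "(c, a, b) \<in> X" using True ch by (simp add: X_def)
      then show ?thesis by (force simp: abc)
    next
      case False
      then have "a \<notin> C" "b \<notin> C" "c \<notin> C" using ch by (auto simp: D_def)
      note e = this[THEN same]
      have "(a, c) \<in> F" "(b, c) \<in> F" using ch(2,3) e by blast+
      then show ?thesis using ch e by (simp add: cherries_def abc)
    qed
  qed
  then have "card (cherries E) \<le> card (cherries F \<union> (\<lambda>(c, a, b). (a, b, c)) ` X)"
    using finX finite_cherries[OF F(2)] by (intro card_mono) auto
  also have "\<dots> \<le> card (cherries F) + card ((\<lambda>(c, a, b). (a, b, c)) ` X)" by (rule card_Un_le)
  also have "\<dots> \<le> card (cherries F) + card X" using card_image_le[OF finX] by simp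
  finally show ?thesis using cX by simp
qed

definition plant_cherry :: "'a \<Rightarrow> 'a \<Rightarrow> 'a \<Rightarrow> 'a \<Rightarrow> ('a \<times> 'a) set \<Rightarrow> ('a \<times> 'a) set" where
  "plant_cherry a b c x E = add_leaf a c (add_leaf b c (add_leaf c x E))"

text \<open>
  The second and the last fact make planting invertible: the third neighbour of $c$ is $x$, and the old tree is
  what is left after deleting the cherry.
\<close>
lemma plant_cherry:
  assumes T: "tree_rel V E" and new: "a \<notin> V" "b \<notin> V" "c \<notin> V" "distinct [a, b, c]" and x: "x \<in> V"
  shows plant_cherry_tree: "tree_rel (insert a (insert b (insert c V))) (plant_cherry a b c x E)"
    and plant_cherry_nbrs: "plant_cherry a b c x E `` {c} = {a, b, x}"
    and plant_cherry_is_cherry: "(a, b, c) \<in> cherries (plant_cherry a b c x E)"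
    and plant_cherry_restrict: "plant_cherry a b c x E \<inter> V \<times> V = E"
proof -
  have E: "E \<subseteq> V \<times> V" by (rule tree_relD(3)[OF T])
  show "tree_rel (insert a (insert b (insert c V))) (plant_cherry a b c x E)"
    unfolding plant_cherry_def using assms by (intro tree_rel_add_leaf) auto
  have na: "plant_cherry a b c x E `` {a} = {c}" and nb: "plant_cherry a b c x E `` {b} = {c}"
    and nc: "plant_cherry a b c x E `` {c} = {a, b, x}"
    using E new x by (auto simp: plant_cherry_def add_leaf_def)
  show "plant_cherry a b c x E `` {c} = {a, b, x}" by (rule nc)
  have "a \<noteq> x" "b \<noteq> x" using new x by auto
  then have "card {a, b, x} = 3" using new by simp
  then show "(a, b, c) \<in> cherries (plant_cherry a b c x E)"
    unfolding cherries_def using na nb nc new by (auto simp: plant_cherry_def add_leaf_def)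
  show "plant_cherry a b c x E \<inter> V \<times> V = E" using E new x by (auto simp: plant_cherry_def add_leaf_def)
qed

section \<open>Trees with few cherries are rare\<close>

lemma finite_trees: "finite V \<Longrightarrow> finite {E. tree_rel V E}"
  by (rule finite_subset[of _ "Pow (V \<times> V)"]) (auto simp: tree_rel_def)

text \<open>
  Three suppressions of a tree with few cherries keep at least one state for every 729 trees.  The
  three suppressed vertices can then be planted as a cherry at each of the remaining vertices.  The
  resulting tree on the original vertex set, together with its marked cherry, determines the state and
  the vertex; and it has boundedly many cherries that could be the marked one.  This gains a factor
  \<open>card V - 3\<close> over a constant.
\<close>
lemma few_cherries_rare:
  fixes V :: "'a set"
  assumes V: "finite V" "card V \<ge> 4"
  shows "card {E. tree_rel V E \<and> card (cherries E) \<le> q} * (card V - 3)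
     \<le> 729 * (q + 180) * card {E. tree_rel V E}"
proof -
  \<comment> \<open>\<open>P\<close> consists of the states with a place for planting, \<open>M\<close> of the trees with a marked cherry;
    \<open>f\<close> plants.  The constant 180 is 18 times the number of vertices whose neighbourhood may change:
    three for each suppression, and the vertex at which the cherry is planted.\<close>
  define B where "B = {E. tree_rel V E \<and> card (cherries E) \<le> q}"
  define A where "A = suppressions V B 3"
  define G where "G = {E. tree_rel V E \<and> card (cherries E) \<le> q + 180}"
  define M where "M = (SIGMA E:G. (\<lambda>(a, b, c). [c, b, a]) ` cherries E)"
  define P where "P = (SIGMA (E :: ('a \<times> 'a) set, us):A. V - set us)"
  define f where "f = (\<lambda>((E :: ('a \<times> 'a) set, us), x). (plant_cherry (us ! 2) (us ! 1) (us ! 0) x E, us))"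
  have B: "tree_rel V E" if "E \<in> B" for E using that by (simp add: B_def)
  have fB: "finite B" unfolding B_def using finite_trees[OF V(1)] by (rule rev_finite_subset) auto
  have fA: "finite A" unfolding A_def by (rule finite_suppressions[OF V(1) fB])
  have inv: "\<exists>a b c. us = [c, b, a] \<and> distinct [a, b, c] \<and> {a, b, c} \<subseteq> V \<and> tree_rel (V - {a, b, c}) E \<and>
     (\<exists>T\<in>B. \<exists>C. finite C \<and> card C \<le> 9 \<and> {a, b, c} \<subseteq> C \<and> (\<forall>p. p \<notin> C \<longrightarrow> E `` {p} = T `` {p}))"
    if "(E, us) \<in> A" for E us
  proof -
    have "3 < card V" using V(2) by simp
    note i = suppressions_invariant[where V = V and B = B and k = 3 and E = E and us = us,
        OF B this that[unfolded A_def], simplified]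
    then have i1: "length us = 3" by blast
    obtain c b a where us: "us = [c, b, a]"
      using i1 by (auto simp: numeral_3_eq_3 length_Suc_conv)
    have "set us = {a, b, c}" by (auto simp: us)
    have d: "distinct [a, b, c]" using i us by auto
    have "us = [c, b, a] \<and> distinct [a, b, c] \<and> {a, b, c} \<subseteq> V \<and> tree_rel (V - {a, b, c}) E \<and>
      (\<exists>T\<in>B. \<exists>C. finite C \<and> card C \<le> 9 \<and> {a, b, c} \<subseteq> C \<and> (\<forall>p. p \<notin> C \<longrightarrow> E `` {p} = T `` {p}))"
      using i d us unfolding \<open>set us = {a, b, c}\<close> by (intro conjI) simp_all
    then show ?thesis by (intro exI)
  qed
  have img: "f ` P \<subseteq> M"
  proof
    fix y assume "y \<in> f ` P"
    then obtain E us x where p: "(E, us) \<in> A" "x \<in> V" "x \<notin> set us"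
      "y = (plant_cherry (us ! 2) (us ! 1) (us ! 0) x E, us)"
      by (auto simp: f_def P_def)
    from inv[OF p(1)] obtain a b c where i: "us = [c, b, a]" "distinct [a, b, c]" "{a, b, c} \<subseteq> V"
        "tree_rel (V - {a, b, c}) E"
      and ex: "\<exists>T\<in>B. \<exists>C. finite C \<and> card C \<le> 9 \<and> {a, b, c} \<subseteq> C \<and>
        (\<forall>p. p \<notin> C \<longrightarrow> E `` {p} = T `` {p})"
      by (elim exE conjE)
    from ex obtain T where T: "T \<in> B" and ex': "\<exists>C. finite C \<and> card C \<le> 9 \<and> {a, b, c} \<subseteq> C \<and>
        (\<forall>p. p \<notin> C \<longrightarrow> E `` {p} = T `` {p})" by (elim bexE)
    from ex' obtain C where C: "finite C" "card C \<le> 9" "{a, b, c} \<subseteq> C"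
      "\<forall>p. p \<notin> C \<longrightarrow> E `` {p} = T `` {p}" by (elim exE conjE)
    let ?E = "plant_cherry a b c x E"
    have x: "x \<in> V - {a, b, c}" using p(2,3) by (auto simp: i(1))
    have y: "y = (?E, us)" by (simp add: p(4) i(1))
    have "tree_rel (insert a (insert b (insert c (V - {a, b, c})))) ?E"
      by (rule plant_cherry_tree[OF i(4)]) (use i(2) x in auto)
    moreover have "insert a (insert b (insert c (V - {a, b, c}))) = V" using i(3) by auto
    ultimately have t: "tree_rel V ?E" by simp
    have ch: "(a, b, c) \<in> cherries ?E"
      by (rule plant_cherry_is_cherry[OF i(4)]) (use i(2) x in auto)
    have same: "?E `` {p} = T `` {p}" if "p \<notin> insert x C" for p
    proof -
      have "?E `` {p} = E `` {p}" using that C(3) by (auto simp: plant_cherry_def add_leaf_def)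
      then show ?thesis using that C(4) by simp
    qed
    have tT: "tree_rel V T" using B T .
    have "card (cherries ?E) \<le> card (cherries T) + 18 * card (insert x C)"
      by (rule card_cherries_perturb)
        (use t tT C(1) same in \<open>auto intro: tree_rel_finite tree_relD(4)\<close>)
    moreover have "card (insert x C) \<le> 10" using C(1,2) by (simp add: card_insert_if)
    moreover have "card (cherries T) \<le> q" using T by (simp add: B_def)
    ultimately have "?E \<in> G" using t by (simp add: G_def)
    moreover have "us \<in> (\<lambda>(a, b, c). [c, b, a]) ` cherries ?E"
      using ch by (rule rev_image_eqI) (simp add: i(1))
    ultimately show "y \<in> M" by (simp add: M_def y)
  qed
  have inj: "inj_on f P"
  proof (rule inj_onI)
    fix p p' assume p: "p \<in> P" "p' \<in> P" "f p = f p'"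
    obtain E us x where 1: "p = ((E, us), x)" by (metis surj_pair)
    obtain E' us' x' where 2: "p' = ((E', us'), x')" by (metis surj_pair)
    have us: "us' = us" using p(3) by (simp add: f_def 1 2)
    have A: "(E, us) \<in> A" "x \<in> V - set us" "(E', us) \<in> A" "x' \<in> V - set us"
      using p(1,2) by (auto simp: P_def 1 2 us)
    obtain a b c where i: "us = [c, b, a]" "distinct [a, b, c]" "tree_rel (V - {a, b, c}) E"
      using inv[OF A(1)] by (elim exE conjE)
    have i': "tree_rel (V - {a, b, c}) E'" using inv[OF A(3)] i(1) by auto
    have x: "x \<in> V - {a, b, c}" "x' \<in> V - {a, b, c}" using A by (auto simp: i(1))
    have eq: "plant_cherry a b c x E = plant_cherry a b c x' E'"
      using p(3) by (simp add: f_def 1 2 us i(1))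
    have "plant_cherry a b c x E \<inter> (V - {a, b, c}) \<times> (V - {a, b, c}) = E"
      by (rule plant_cherry_restrict[OF i(3)]) (use i(2) x in auto)
    moreover have "plant_cherry a b c x' E' \<inter> (V - {a, b, c}) \<times> (V - {a, b, c}) = E'"
      by (rule plant_cherry_restrict[OF i']) (use i(2) x in auto)
    moreover have "plant_cherry a b c x E `` {c} = {a, b, x}"
      by (rule plant_cherry_nbrs[OF i(3)]) (use i(2) x in auto)
    moreover have "plant_cherry a b c x' E' `` {c} = {a, b, x'}"
      by (rule plant_cherry_nbrs[OF i']) (use i(2) x in auto)
    ultimately have "E = E'" "{a, b, x} = {a, b, x'}" using eq by auto
    moreover from this(2) have "x = x'" using x by auto
    ultimately show "p = p'" by (simp add: 1 2 us)
  qed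
  have fG: "finite G" unfolding G_def using finite_trees[OF V(1)] by (rule rev_finite_subset) auto
  have fc: "finite (cherries E)" if "E \<in> G" for E
    using that by (intro finite_cherries tree_rel_finite[of V]) (simp add: G_def)
  have fM: "finite M" unfolding M_def using fG fc by auto
  have "card M = (\<Sum>E\<in>G. card ((\<lambda>(a, b, c). [c, b, a]) ` cherries E))"
    unfolding M_def using fG fc by (intro card_SigmaI) auto
  also have "\<dots> \<le> (\<Sum>E\<in>G. q + 180)"
  proof (rule sum_mono)
    fix E assume "E \<in> G"
    then show "card ((\<lambda>(a, b, c). [c, b, a]) ` cherries E) \<le> q + 180"
      using card_image_le[OF fc] by (fastforce simp: G_def intro: order_trans)
  qed
  also have "\<dots> = (q + 180) * card G" by simp
  also have "\<dots> \<le> (q + 180) * card {E. tree_rel V E}"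
    by (intro mult_le_mono2 card_mono finite_trees V) (auto simp: G_def)
  finally have cM: "card M \<le> (q + 180) * card {E. tree_rel V E}" .
  have "card (V - set us) = card V - 3" if "(E, us) \<in> A" for E us
  proof -
    obtain a b c where "us = [c, b, a]" "distinct [a, b, c]" "{a, b, c} \<subseteq> V"
      using inv[OF \<open>(E, us) \<in> A\<close>] by (elim exE conjE)
    then show ?thesis using V(1) by (subst card_Diff_subset) auto
  qed
  then have c: "card (case a of (E, us) \<Rightarrow> V - set us) = card V - 3" if "a \<in> A" for a
    using that by (cases a) auto
  have "card P = (\<Sum>a\<in>A. card (case a of (E, us) \<Rightarrow> V - set us))"
    unfolding P_def using fA V(1) by (subst card_SigmaI) auto
  then have "card A * (card V - 3) = card P" using c by simp
  also have "\<dots> = card (f ` P)" using inj by (simp add: card_image)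
  also have "\<dots> \<le> card M" by (rule card_mono[OF fM img])
  also note cM
  finally have cA: "card A * (card V - 3) \<le> (q + 180) * card {E. tree_rel V E}" .
  have "card B \<le> 729 * card A"
    using card_suppressions[OF V(1) fB B, where k = 3] V(2) by (simp add: A_def)
  then have "card B * (card V - 3) \<le> 729 * card A * (card V - 3)" by (rule mult_le_mono1)
  also have "\<dots> = 729 * (card A * (card V - 3))" by simp
  also have "\<dots> \<le> 729 * ((q + 180) * card {E. tree_rel V E})" using cA by (rule mult_le_mono2)
  finally show ?thesis by (simp only: B_def mult.assoc)
qed

section \<open>Labelled trees\<close>

lemma labelled_trees_eq:
  "labelled_trees n = (\<lambda>E. \<lparr>pverts = {1..n}, parcs = E\<rparr>) ` {E. tree_rel {1..n} E}"
proof -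
  have "undirected_tree T \<longleftrightarrow> tree_rel (pverts T) (parcs T)" for T :: "nat pair_pre_digraph"
    using undirected_tree_imp_tree_rel tree_rel_imp_undirected_tree by blast
  then have iff: "T \<in> labelled_trees n \<longleftrightarrow> tree_rel {1..n} (parcs T) \<and> pverts T = {1..n}" for T
    by (cases "pverts T = {1..n}") (simp_all add: labelled_trees_def)
  show ?thesis
  proof (intro equalityI subsetI)
    fix T assume "T \<in> labelled_trees n"
    then have "tree_rel {1..n} (parcs T)" "T = \<lparr>pverts = {1..n}, parcs = parcs T\<rparr>"
      by (simp_all add: iff)
    then show "T \<in> (\<lambda>E. \<lparr>pverts = {1..n}, parcs = E\<rparr>) ` {E. tree_rel {1..n} E}" by blast
  next
    fix T assume "T \<in> (\<lambda>E. \<lparr>pverts = {1..n}, parcs = E\<rparr>) ` {E. tree_rel {1..n} E}"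
    then obtain E where "tree_rel {1..n} E" "T = \<lparr>pverts = {1..n}, parcs = E\<rparr>" by blast
    then show "T \<in> labelled_trees n" by (simp add: iff)
  qed
qed

lemma out_degree_eq_card_Image: "out_degree (with_proj T) u = card (parcs T `` {u})"
proof -
  have "out_arcs (with_proj T) u = Pair u ` (parcs T `` {u})" by (auto simp: out_arcs_def)
  then show ?thesis by (simp add: out_degree_def card_image inj_on_def)
qed

lemma cherry_iff_cherries:
  assumes "tree_rel (pverts T) (parcs T)"
  shows "cherry T a b c \<longleftrightarrow> (a, b, c) \<in> cherries (parcs T)"
  using tree_relD(3,7)[OF assms] by (auto simp: cherry_def cherries_def out_degree_eq_card_Image)

text \<open>
  The ordered cherries are the triples counted by \<^const>\<open>num_cherries\<close> and those obtained from them
  by exchanging the two leaves.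
\<close>
lemma card_cherries_le_num_cherries:
  assumes "tree_rel {1..n} (parcs T)" "pverts T = {1..n}"
  shows "card (cherries (parcs T)) \<le> 2 * num_cherries n T"
proof -
  let ?E = "parcs T"
  let ?I = "\<lambda>j. {(i1, i2). 1 \<le> i2 \<and> i2 < i1 \<and> i1 \<le> n \<and> i1 \<noteq> j \<and> i2 \<noteq> j}"
  have fI: "finite (?I j)" for j by (rule finite_subset[of _ "{1..n} \<times> {1..n}"]) auto
  define Q where "Q = (SIGMA j:{1..n}. {p \<in> ?I j. cherry T (fst p) (snd p) j})"
  have "num_cherries n T = (\<Sum>j=1..n. card {p \<in> ?I j. cherry T (fst p) (snd p) j})"
    unfolding num_cherries_def cherry_indicator_def case_prod_unfold
    using fI by (intro sum.cong refl) (simp add: sum.If_cases Int_def case_prod_unfold)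
  also have "\<dots> = card Q" unfolding Q_def using fI by (subst card_SigmaI) auto
  finally have num: "num_cherries n T = card Q" .
  have fQ: "finite Q" unfolding Q_def using fI by (intro finite_SigmaI) auto
  have E: "?E \<subseteq> {1..n} \<times> {1..n}" "\<And>a. (a, a) \<notin> ?E" using tree_relD(3,7)[OF assms(1)] by auto
  have ch: "cherry T a b c \<longleftrightarrow> (a, b, c) \<in> cherries ?E" for a b c
    using cherry_iff_cherries[of T a b c] assms by simp
  have "cherries ?E \<subseteq> (\<lambda>(j, i1, i2). (i1, i2, j)) ` Q \<union> (\<lambda>(j, i1, i2). (i2, i1, j)) ` Q"
  proof
    fix t assume t: "t \<in> cherries ?E"
    obtain a b c where abc: "t = (a, b, c)" by (metis surj_pair)
    have ab: "a \<noteq> b" "(a, c) \<in> ?E" "(b, c) \<in> ?E" "(b, a, c) \<in> cherries ?E"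
      using t by (auto simp: abc cherries_def)
    then have r: "a \<in> {1..n}" "b \<in> {1..n}" "c \<in> {1..n}" "a \<noteq> c" "b \<noteq> c" using E by auto
    show "t \<in> (\<lambda>(j, i1, i2). (i1, i2, j)) ` Q \<union> (\<lambda>(j, i1, i2). (i2, i1, j)) ` Q"
    proof (cases "b < a")
      case True
      then have "(c, a, b) \<in> Q" using r t by (simp add: Q_def ch abc)
      then have "t \<in> (\<lambda>(j, i1, i2). (i1, i2, j)) ` Q" by (rule rev_image_eqI) (simp add: abc)
      then show ?thesis ..
    next
      case False
      then have "(c, b, a) \<in> Q" using r ab by (simp add: Q_def ch)
      then have "t \<in> (\<lambda>(j, i1, i2). (i2, i1, j)) ` Q" by (rule rev_image_eqI) (simp add: abc)
      then show ?thesis ..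
    qed
  qed
  then have "card (cherries ?E) \<le> card ((\<lambda>(j, i1, i2). (i1, i2, j)) ` Q \<union> (\<lambda>(j, i1, i2). (i2, i1, j)) ` Q)"
    using fQ by (intro card_mono) auto
  also have "\<dots> \<le> card ((\<lambda>(j, i1, i2). (i1, i2, j)) ` Q) + card ((\<lambda>(j, i1, i2). (i2, i1, j)) ` Q)"
    by (rule card_Un_le)
  also have "\<dots> \<le> card Q + card Q" using fQ by (intro add_mono card_image_le)
  finally show ?thesis using num by simp
qed

text \<open>
  Fewer than two cherries means at most two ordered ones, so the constant is \<open>729 * (2 + 180)\<close>.
\<close>
lemma prob_num_cherries_ge_2:
  assumes "n \<ge> 4"
  shows "1 - 132678 / (real n - 3)
    \<le> measure_pmf.prob (pmf_of_set (labelled_trees n)) {T. num_cherries n T \<ge> 2}"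
proof -
  let ?L = "labelled_trees n" and ?V = "{1..n}" and ?graph = "\<lambda>E. \<lparr>pverts = {1..n}, parcs = E\<rparr>"
  let ?few = "?L \<inter> {T. \<not> num_cherries n T \<ge> 2}"
  have fL: "finite ?L" unfolding labelled_trees_eq by (simp add: finite_trees)
  obtain E where "tree_rel ?V E" using tree_rel_exists[of ?V] assms by auto
  then have neL: "?L \<noteq> {}" unfolding labelled_trees_eq by blast
  have inj: "inj ?graph" by (auto simp: inj_def)
  have cL: "card ?L = card {E. tree_rel ?V E}"
    unfolding labelled_trees_eq by (rule card_image) (use inj inj_on_subset in blast)
  have "?few \<subseteq> ?graph ` {E. tree_rel ?V E \<and> card (cherries E) \<le> 2}"
  proof
    fix T assume T: "T \<in> ?few"
    then obtain E where E: "T = ?graph E" "tree_rel ?V E" by (auto simp: labelled_trees_eq)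
    have "card (cherries E) \<le> 2 * num_cherries n T"
      using card_cherries_le_num_cherries[of n T] E by simp
    then have "card (cherries E) \<le> 2" using T by simp
    then show "T \<in> ?graph ` {E. tree_rel ?V E \<and> card (cherries E) \<le> 2}" using E by blast
  qed
  then have "card ?few \<le> card {E. tree_rel ?V E \<and> card (cherries E) \<le> 2}"
    by (rule surj_card_le[rotated]) (rule finite_subset[OF _ finite_trees[of ?V]], auto)
  then have "card ?few * (n - 3) \<le> card {E. tree_rel ?V E \<and> card (cherries E) \<le> 2} * (n - 3)"
    by (rule mult_le_mono1)
  also have "\<dots> \<le> 132678 * card ?L"
    using few_cherries_rare[of ?V 2] assms by (simp add: cL)
  finally have "real (card ?few) * real (n - 3) \<le> 132678 * real (card ?L)"
    by (metis of_nat_le_iff of_nat_mult of_nat_numeral)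
  moreover have "real (card ?L) > 0" "real (n - 3) > 0" using fL neL assms by (auto simp: card_gt_0_iff)
  ultimately have few: "real (card ?few) / real (card ?L) \<le> 132678 / real (n - 3)"
    by (simp add: field_simps)
  have "measure_pmf.prob (pmf_of_set ?L) {T. num_cherries n T \<ge> 2}
      = 1 - measure_pmf.prob (pmf_of_set ?L) {T. \<not> num_cherries n T \<ge> 2}"
    by (subst measure_pmf.prob_compl[symmetric]) (auto intro!: arg_cong[of _ _ "measure _"])
  also have "measure_pmf.prob (pmf_of_set ?L) {T. \<not> num_cherries n T \<ge> 2} = card ?few / card ?L"
    by (rule measure_pmf_of_set[OF neL fL])
  finally show ?thesis using few assms by (simp add: of_nat_diff)
qed

theorem theorem3p10:
  shows "(\<lambda>n. measure_pmf.prob (pmf_of_set (labelled_trees n)) {T. num_cherries n T \<ge> 2})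
           \<longlonglongrightarrow> 1"
proof (rule tendsto_sandwich)
  show "(\<lambda>n. 1 - 132678 / (real n - 3)) \<longlonglongrightarrow> 1" by real_asymp
  show "\<forall>\<^sub>F n in sequentially. 1 - 132678 / (real n - 3)
      \<le> measure_pmf.prob (pmf_of_set (labelled_trees n)) {T. num_cherries n T \<ge> 2}"
    using eventually_ge_at_top[of 4] by eventually_elim (rule prob_num_cherries_ge_2)
  show "\<forall>\<^sub>F n in sequentially.
      measure_pmf.prob (pmf_of_set (labelled_trees n)) {T. num_cherries n T \<ge> 2} \<le> 1"
    by (simp add: measure_pmf.prob_le_1)
qed (rule tendsto_const)

end
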